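(* For all pairs of integers $t\ge 3$ and $s\ge 1$ there exists a threshold $r_0=r_0(s,t)>s$ such that $$\chi_r(W(s,t))>t+2(r-1)$$ for every integer $r\ge r_0$.
   Context: Graphs are finite, simple and undirected. For positive integers $s,t$ the graph $W(s,t)$ has vertex set consisting of all sequences $(x_1,\dots,x_t)$ with $x_i\in\{0,1,\dots,s\}$ for all $i$, such that there is exactly one index $i$ with $x_i=0$ and at least one index $j$ with $x_j=1$. Two vertices $(x_1,\dots,x_t)$ and $(y_1,\dots,y_t)$ are adjacent if and only if for every $i$ either $|x_i-y_i|=1$ or $x_i=y_i=s$. For a graph $G$ and a positive integer $r$, the $r$-fold chromatic number ($r$-th multichromatic number) $\chi_r(G)$ is the minimum $n$ such that one can assign to each vertex of $G$ a set of exactly $r$ distinct colors from $\{1,\dots,n\}$ in such a way that adjacent vertices receive disjoint sets. (Equivalently, $G$ admits a homomorphism to the Kneser graph whose vertices are the $r$-element subsets of $\{1,\dots,n\}$, two being adjacent if and only if they are disjoint.) *)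

theory Defs
  imports "Graph_Theory.Pair_Digraph"
begin

text \<open>
  Finite simple undirected graphs are the instances of the locale \<^locale>\<open>pair_graph\<close>: an
  undirected edge between \<open>u\<close> and \<open>v\<close> is the pair of arcs \<open>(u, v)\<close> and \<open>(v, u)\<close>.
\<close>

definition multicoloring :: "'a pair_pre_digraph \<Rightarrow> nat \<Rightarrow> nat \<Rightarrow> ('a \<Rightarrow> nat set) \<Rightarrow> bool" where
  "multicoloring G r n f \<longleftrightarrow>
     (\<forall>v\<in>pverts G. f v \<subseteq> {1..n} \<and> card (f v) = r) \<and>
     (\<forall>(u, v)\<in>parcs G. f u \<inter> f v = {})"

definition multichromatic_number :: "nat \<Rightarrow> 'a pair_pre_digraph \<Rightarrow> nat" where
  "multichromatic_number r G = (LEAST n. \<exists>f. multicoloring G r n f)"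

text \<open>The minimum is attained on every finite simple graph, so the \<open>LEAST\<close> is never vacuous.\<close>

lemma (in pair_graph) multichromatic_number_attained:
  "\<exists>f. multicoloring G r (multichromatic_number r G) f"
proof -
  obtain h :: "'a \<Rightarrow> nat" and m where h: "h ` pverts G = {i. i < m}" "inj_on h (pverts G)"
    using finite_imp_inj_to_nat_seg[OF pair_finite_verts] by auto
  define f where "f v = {h v * r + 1..h v * r + r}" for v
  have le: "h v * r + r \<le> m * r" if "v \<in> pverts G" for v
  proof -
    have "h v < m" using that h(1) by blast
    then have "Suc (h v) * r \<le> m * r" by (intro mult_le_mono1) simp
    then show ?thesis by simp
  qed
  have lt: "f u \<inter> f v = {}" if "h u < h v" for u v
  proof -
    have "Suc (h u) * r \<le> h v * r" using that by (intro mult_le_mono1) auto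
    then show ?thesis by (auto simp: f_def)
  qed
  have "f u \<inter> f v = {}" if "(u, v) \<in> parcs G" for u v
  proof -
    have "u \<noteq> v" "u \<in> pverts G" "v \<in> pverts G"
      using that no_loops' in_arcsD1 in_arcsD2 by auto
    then have "h u \<noteq> h v" using h(2) by (auto dest: inj_onD)
    then show ?thesis using lt[of u v] lt[of v u] by (auto simp: neq_iff)
  qed
  moreover have "f v \<subseteq> {1..m * r} \<and> card (f v) = r" if "v \<in> pverts G" for v
    using le[OF that] by (auto simp: f_def)
  ultimately have "multicoloring G r (m * r) f"
    by (auto simp: multicoloring_def)
  then have "\<exists>f. multicoloring G r (m * r) f" by blast
  then show ?thesis unfolding multichromatic_number_def by (rule LeastI)
qed

text \<open>
  A sequence \<open>(x\<^sub>1, \<dots>, x\<^sub>t)\<close> is a list of length \<open>t\<close>; its positions are numbered from \<open>0\<close>.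
\<close>

definition W_verts :: "nat \<Rightarrow> nat \<Rightarrow> nat list set" where
  "W_verts s t = {x. length x = t \<and> set x \<subseteq> {0..s} \<and>
     (\<exists>!i. i < t \<and> x ! i = 0) \<and> (\<exists>j<t. x ! j = 1)}"

definition W_adj :: "nat \<Rightarrow> nat \<Rightarrow> nat list \<Rightarrow> nat list \<Rightarrow> bool" where
  "W_adj s t x y \<longleftrightarrow>
     (\<forall>i<t. \<bar>int (x ! i) - int (y ! i)\<bar> = 1 \<or> (x ! i = s \<and> y ! i = s))"

definition W :: "nat \<Rightarrow> nat \<Rightarrow> nat list pair_pre_digraph" where
  "W s t = \<lparr>pverts = W_verts s t,
            parcs = {(x, y). x \<in> W_verts s t \<and> y \<in> W_verts s t \<and> W_adj s t x y}\<rparr>"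

lemma pair_graph_W:
  assumes "s \<ge> 1"
  shows "pair_graph (W s t)"
proof
  have "W_verts s t \<subseteq> {x. set x \<subseteq> {0..s} \<and> length x = t}"
    by (auto simp: W_verts_def)
  then have fin: "finite (W_verts s t)"
    using finite_lists_length_eq[of "{0..s}" t] finite_subset by blast
  then show "finite (pverts (W s t))" by (simp add: W_def)
  have "parcs (W s t) \<subseteq> W_verts s t \<times> W_verts s t" by (auto simp: W_def)
  then show "finite (parcs (W s t))" using fin finite_subset by blast
  show "fst e \<in> pverts (W s t)" "snd e \<in> pverts (W s t)" if "e \<in> parcs (W s t)" for e
    using that by (auto simp: W_def)
  show "fst e \<noteq> snd e" if e: "e \<in> parcs (W s t)" for e
  proof
    assume "fst e = snd e"
    then obtain x where x: "x \<in> W_verts s t" "W_adj s t x x"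
      using e by (cases e) (auto simp: W_def)
    then obtain i where "i < t" "x ! i = 0" by (auto simp: W_verts_def)
    with x(2) assms show False by (auto simp: W_adj_def)
  qed
  show "symmetric (with_proj (W s t))"
    by (auto simp: W_def W_adj_def symmetric_def arcs_ends_def arc_to_ends_def sym_def
        abs_minus_commute)
qed

end

theory Submission
  imports Defs
begin

text \<open>
  If \<open>n\<close> colours suffice for an \<open>r\<close>-fold colouring, then two vertices with a common neighbour both
  receive \<open>r\<close> of the \<open>n - r\<close> colours missing at that neighbour, so at most \<open>n - 2 r\<close> colours change
  between them. Along a closed walk of length \<open>2 k + 1\<close> all \<open>r\<close> colours must be exchanged within the
  first \<open>2 k\<close> steps, whence \<open>r \<le> k (n - 2 r)\<close>. For \<open>n \<le> t + 2 (r - 1)\<close> this bounds \<open>r\<close> by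
  \<open>k (t - 2)\<close>, so it suffices to exhibit one odd closed walk in \<open>W(s,t)\<close>.
  In that walk all but three coordinates stay equal to \<open>s\<close>.
\<close>

context pair_wf_digraph
begin

lemma multicoloring_change_two_steps:
  assumes f: "multicoloring G r n f" and "(x, y) \<in> parcs G" "(y, z) \<in> parcs G"
  shows "card (f x - f z) \<le> n - 2 * r"
proof -
  have col: "f v \<subseteq> {1..n}" "card (f v) = r" "finite (f v)" if "v \<in> pverts G" for v
    using f that finite_subset[of "f v" "{1..n}"] by (auto simp: multicoloring_def)
  have v: "x \<in> pverts G" "y \<in> pverts G" "z \<in> pverts G"
    using assms(2,3) in_arcsD1 in_arcsD2 by blast+
  have "f x \<inter> f y = {}" "f y \<inter> f z = {}"
    using f assms(2,3) by (auto simp: multicoloring_def)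
  \<comment> \<open>The three sets are pairwise disjoint, and the last two have size
    \<open>r\<close> each.\<close>
  then have "card ((f x - f z) \<union> f y \<union> f z) = card (f x - f z) + card (f y) + card (f z)"
    using col(3) v by (subst card_Un_disjoint; (subst card_Un_disjoint)?) auto
  moreover have "card ((f x - f z) \<union> f y \<union> f z) \<le> card {1..n}"
    using col(1)[OF v(1)] col(1)[OF v(2)] col(1)[OF v(3)] by (intro card_mono) auto
  ultimately show ?thesis using col(2) v by simp
qed

lemma multicoloring_change_even_walk:
  assumes f: "multicoloring G r n f" and x: "x \<in> pverts G"
  shows "(x, y) \<in> parcs G ^^ (2 * k) \<Longrightarrow> card (f x - f y) \<le> k * (n - 2 * r)"
proof (induction k arbitrary: y)
  case (Suc k)
  then obtain z w where z: "(x, z) \<in> parcs G ^^ (2 * k)" "(z, w) \<in> parcs G" "(w, y) \<in> parcs G"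
    by auto
  have "finite (f v)" if "v \<in> pverts G" for v
    using f that finite_subset[of "f v" "{1..n}"] by (auto simp: multicoloring_def)
  then have "finite (f x)" "finite (f z)" using x in_arcsD1[OF z(2)] by auto
  \<comment> \<open>A colour lost between \<open>x\<close> and \<open>y\<close> is lost either
    before or after \<open>z\<close>.\<close>
  then have "card (f x - f y) \<le> card ((f x - f z) \<union> (f z - f y))"
    by (intro card_mono) auto
  also have "\<dots> \<le> card (f x - f z) + card (f z - f y)" by (rule card_Un_le)
  also have "\<dots> \<le> k * (n - 2 * r) + (n - 2 * r)"
    using Suc.IH[OF z(1)] multicoloring_change_two_steps[OF f z(2,3)] by (rule add_mono)
  finally show ?case by simp
qed simp

lemma multicoloring_odd_closed_walk:
  assumes f: "multicoloring G r n f" and walk: "(x, x) \<in> parcs G ^^ Suc (2 * k)"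
  shows "r \<le> k * (n - 2 * r)"
proof -
  obtain y where y: "(x, y) \<in> parcs G ^^ (2 * k)" "(y, x) \<in> parcs G" using walk by auto
  have x: "x \<in> pverts G" using y(2) in_arcsD2 by blast
  then have "card (f x) = r" using f by (auto simp: multicoloring_def)
  moreover have "f x - f y = f x" using f y(2) by (auto simp: multicoloring_def)
  ultimately show ?thesis using multicoloring_change_even_walk[OF f x y(1)] by simp
qed

end

text \<open>Two entries equal to \<open>s\<close> satisfy the second alternative of adjacency, so
  the coordinates outside \<open>u\<close>, \<open>v\<close>, \<open>w\<close> may stay
  fixed.\<close>

definition three_coords :: "nat \<Rightarrow> nat \<Rightarrow> nat \<Rightarrow> nat \<Rightarrow> nat \<Rightarrow> nat \<Rightarrow> nat \<Rightarrow> nat \<Rightarrow> nat list" where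
  "three_coords s t u v w a b c = map ((\<lambda>_. s)(u := a, v := b, w := c)) [0..<t]"

lemma three_coords_swap:
  assumes "u \<noteq> v" "v \<noteq> w" "u \<noteq> w"
  shows "three_coords s t u v w a b c = three_coords s t v u w b a c"
    and "three_coords s t u v w a b c = three_coords s t u w v a c b"
  using assms by (auto simp: three_coords_def)

text \<open>The pair \<open>a\<close>, \<open>b\<close> supplies the required 0 and 1;
  \<open>1 \<le> c\<close> excludes a second 0.\<close>

lemma three_coords_in_W_verts:
  assumes "u < t" "v < t" "w < t" "u \<noteq> v" "v \<noteq> w" "u \<noteq> w"
    and "a = 0 \<and> b = 1 \<or> a = 1 \<and> b = 0" "1 \<le> c" "c \<le> s"
  shows "three_coords s t u v w a b c \<in> W_verts s t"
proof -
  let ?x = "three_coords s t u v w a b c"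
  have nth: "?x ! i = ((\<lambda>_. s)(u := a, v := b, w := c)) i" if "i < t" for i
    using that by (simp add: three_coords_def)
  have "set ?x \<subseteq> {0..s}" using assms by (auto simp: three_coords_def)
  moreover have "\<exists>!i. i < t \<and> ?x ! i = 0"
    by (rule ex1I[of _ "if a = 0 then u else v"])
      (use assms nth in \<open>auto split: if_splits\<close>)
  moreover have "\<exists>j<t. ?x ! j = 1"
    by (rule exI[of _ "if a = 1 then u else v"]) (use assms nth in auto)
  ultimately show ?thesis by (simp add: W_verts_def three_coords_def)
qed

lemma W_adj_three_coords:
  assumes "\<bar>int a - int a'\<bar> = 1 \<or> a = s \<and> a' = s"
    and "\<bar>int b - int b'\<bar> = 1 \<or> b = s \<and> b' = s"
    and "\<bar>int c - int c'\<bar> = 1 \<or> c = s \<and> c' = s"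
  shows "W_adj s t (three_coords s t u v w a b c) (three_coords s t u v w a' b' c')"
  using assms by (auto simp: W_adj_def three_coords_def)

text \<open>
  The first coordinate alternates throughout. The third one descends from \<open>s\<close> to \<open>0\<close>, which it
  reaches at time \<open>s\<close>; from then on it replaces the second one as the alternating partner of the
  first, and the second one climbs to \<open>s\<close>.
\<close>

definition exchange_walk :: "nat \<Rightarrow> nat \<Rightarrow> nat \<Rightarrow> nat \<Rightarrow> nat \<Rightarrow> nat \<Rightarrow> nat list" where
  "exchange_walk s t u v w n = (let p = (s + n) mod 2 in
     if n < s then three_coords s t u v w (1 - p) p (s - n)
     else three_coords s t u v w (1 - p) (min s (2 + n - s)) p)"

text \<open>The parity of \<open>s\<close> fixes the phase of the alternation: after
  \<open>s\<close> steps the first coordinate is 1, just as the third one arrives at 0.\<close>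

definition base_vertex :: "nat \<Rightarrow> nat \<Rightarrow> nat \<Rightarrow> nat \<Rightarrow> nat \<Rightarrow> nat list" where
  "base_vertex s t u v w = three_coords s t u v w (1 - s mod 2) (s mod 2) s"

context
  fixes s t u v w :: nat
  assumes s: "s \<ge> 1" and lt: "u < t" "v < t" "w < t" and ne: "u \<noteq> v" "v \<noteq> w" "u \<noteq> w"
begin

lemma exchange_walk_in_W_verts: "exchange_walk s t u v w n \<in> W_verts s t"
proof -
  define p where "p = (s + n) mod 2"
  have p: "1 - p = 0 \<and> p = 1 \<or> 1 - p = 1 \<and> p = 0" by (auto simp: p_def)
  show ?thesis
  proof (cases "n < s")
    case True
    then have "exchange_walk s t u v w n = three_coords s t u v w (1 - p) p (s - n)"
      by (simp add: exchange_walk_def p_def Let_def)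
    then show ?thesis using three_coords_in_W_verts[OF lt ne p, of "s - n" s] True by simp
  next
    case False
    then have "exchange_walk s t u v w n = three_coords s t u w v (1 - p) p (min s (2 + n - s))"
      using three_coords_swap(2)[OF ne] by (simp add: exchange_walk_def p_def Let_def)
    then show ?thesis
      using three_coords_in_W_verts[of u t w v, OF _ _ _ _ _ _ p, of "min s (2 + n - s)" s]
        lt ne s False by simp
  qed
qed

lemma exchange_walk_arc:
  "(exchange_walk s t u v w n, exchange_walk s t u v w (Suc n)) \<in> parcs (W s t)"
proof -
  define p where "p = (s + n) mod 2"
  have p: "p = 0 \<or> p = 1" by (auto simp: p_def)
  have Suc_p: "(s + Suc n) mod 2 = 1 - p" by (auto simp: p_def mod_Suc)
  consider "Suc n < s" | "Suc n = s" | "n \<ge> s" by linarith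
  then have "W_adj s t (exchange_walk s t u v w n) (exchange_walk s t u v w (Suc n))"
  proof cases
    case 1
    then show ?thesis unfolding exchange_walk_def Let_def Suc_p p_def[symmetric]
      using p by (auto intro!: W_adj_three_coords)
  next
    case 2
    \<comment> \<open>At the handover the second and third coordinates are both 1. The third drops
      to 0; the second rises to 2, or stays at 1 if \<open>s = 1\<close>.\<close>
    have "s + n = Suc (2 * n)" using 2 by simp
    then have "p = 1" unfolding p_def by presburger
    then show ?thesis unfolding exchange_walk_def Let_def Suc_p p_def[symmetric]
      using 2 by (auto intro!: W_adj_three_coords)
  next
    case 3
    then show ?thesis unfolding exchange_walk_def Let_def Suc_p p_def[symmetric]
      using p s by (auto intro!: W_adj_three_coords)
  qed
  then show ?thesis using exchange_walk_in_W_verts by (simp add: W_def)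
qed

lemma exchange_last_two:
  "(base_vertex s t u v w, base_vertex s t u w v) \<in> parcs (W s t) ^^ (2 * s)"
proof -
  have "(exchange_walk s t u v w 0, exchange_walk s t u v w n) \<in> parcs (W s t) ^^ n" for n
    by (induction n) (auto intro: exchange_walk_arc)
  moreover have "exchange_walk s t u v w 0 = base_vertex s t u v w"
    using s by (simp add: exchange_walk_def base_vertex_def Let_def)
  moreover have "exchange_walk s t u v w (2 * s) = base_vertex s t u w v"
  proof -
    \<comment> \<open>The phase is that of time 0 again, and the second coordinate is back at
      \<open>s\<close>, as \<open>2 + 2 * s - s\<close> exceeds \<open>s\<close>.\<close>
    have "(s + 2 * s) mod 2 = s mod 2" by presburger
    then show ?thesis
      using three_coords_swap(2)[OF ne] by (simp add: exchange_walk_def base_vertex_def Let_def)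
  qed
  ultimately show ?thesis by metis
qed

text \<open>Swapping 0 and 1 changes both entries by one while all others stay at \<open>s\<close>,
  so a single arc suffices.\<close>

lemma exchange_first_two:
  "(base_vertex s t u v w, base_vertex s t v u w) \<in> parcs (W s t)"
proof -
  let ?p = "s mod 2"
  have p: "1 - ?p = 0 \<and> ?p = 1 \<or> 1 - ?p = 1 \<and> ?p = 0" by auto
  then have q: "?p = 0 \<and> 1 - ?p = 1 \<or> ?p = 1 \<and> 1 - ?p = 0" by auto
  have "base_vertex s t v u w = three_coords s t u v w ?p (1 - ?p) s"
    using three_coords_swap(1)[OF ne] by (simp add: base_vertex_def)
  moreover have "W_adj s t (three_coords s t u v w (1 - ?p) ?p s)
      (three_coords s t u v w ?p (1 - ?p) s)"
    by (rule W_adj_three_coords) (use p in auto)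
  ultimately show ?thesis
    using three_coords_in_W_verts[OF lt ne p s order_refl]
      three_coords_in_W_verts[OF lt ne q s order_refl]
    by (simp add: W_def base_vertex_def)
qed

end

text \<open>
  The two kinds of exchange, applied alternately three times each, generate all six orders of the
  three coordinates and return to the start; the length \<open>3 (2 s + 1)\<close> is odd.
\<close>

lemma W_odd_closed_walk:
  assumes "t \<ge> 3" "s \<ge> 1"
  shows "(base_vertex s t 0 1 2, base_vertex s t 0 1 2) \<in> parcs (W s t) ^^ Suc (2 * (3 * s + 1))"
proof -
  have step: "(base_vertex s t u v w, base_vertex s t v w u) \<in> parcs (W s t) ^^ Suc (2 * s)"
    if "u < t" "v < t" "w < t" "u \<noteq> v" "v \<noteq> w" "u \<noteq> w" for u v w
  proof -
    \<comment> \<open>The two exchanges compose to a cyclic shift of the coordinates, which has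
      order three.\<close>
    have "(base_vertex s t u v w, base_vertex s t v w u) \<in> parcs (W s t) O parcs (W s t) ^^ (2 * s)"
      using exchange_first_two[of s u t v w] exchange_last_two[of s v t u w] that assms by auto
    then show ?thesis by (simp only: relpow.simps relpow_commute)
  qed
  have "(base_vertex s t 0 1 2, base_vertex s t 0 1 2)
      \<in> parcs (W s t) ^^ (Suc (2 * s) + Suc (2 * s) + Suc (2 * s))"
    unfolding relpow_add using step[of 0 1 2] step[of 1 2 0] step[of 2 0 1] assms
    by (intro relcompI[of _ "base_vertex s t 2 0 1"] relcompI[of _ "base_vertex s t 1 2 0"]) auto
  moreover have "Suc (2 * s) + Suc (2 * s) + Suc (2 * s) = Suc (2 * (3 * s + 1))" by simp
  ultimately show ?thesis by (simp only:)
qed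

theorem proposition6:
  fixes s t :: nat
  assumes "t \<ge> 3" and "s \<ge> 1"
  shows "\<exists>r\<^sub>0>s. \<forall>r\<ge>r\<^sub>0. multichromatic_number r (W s t) > t + 2 * (r - 1)"
\<comment> \<open>The first entry ensures \<open>r\<^sub>0 > s\<close>; the second exceeds
  \<open>k * (t - 2)\<close> for the closed walk of length \<open>2 * k + 1\<close> with
  \<open>k = 3 * s + 1\<close>.\<close>
proof (intro exI[of _ "max (Suc s) (Suc ((3 * s + 1) * (t - 2)))"] conjI allI impI)
  fix r assume r: "r \<ge> max (Suc s) (Suc ((3 * s + 1) * (t - 2)))"
  interpret pair_graph "W s t" using pair_graph_W assms(2) .
  define n where "n = multichromatic_number r (W s t)"
  obtain f where "multicoloring (W s t) r n f"
    using multichromatic_number_attained n_def by blast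
  then have le: "r \<le> (3 * s + 1) * (n - 2 * r)"
    using multicoloring_odd_closed_walk W_odd_closed_walk[OF assms] by blast
  show "n > t + 2 * (r - 1)"
  proof (rule ccontr)
    assume "\<not> n > t + 2 * (r - 1)"
    then have "n - 2 * r \<le> t - 2" using assms r by simp
    then have "(3 * s + 1) * (n - 2 * r) \<le> (3 * s + 1) * (t - 2)" by (rule mult_le_mono2)
    then show False using le r by linarith
  qed
qed simp

end
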